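(* Let $I(\varGamma(\mathbb{Z}_{pqr}),x)$ be the independence polynomial of $\varGamma(\mathbb{Z}_{pqr})$, where $p<q<r$ are primes. Then $x=-1$ is a zero of $I(\varGamma(\mathbb{Z}_{pqr}),x)$ with multiplicity $(p-1)(q+r-2)$, and every other complex zero $x$ of $I(\varGamma(\mathbb{Z}_{pqr}),x)$ satisfies $$\frac12<|1+x|<2.$$
   Context: For a positive integer $n$, the zero divisor graph $\varGamma(\mathbb{Z}_n)$ is the simple undirected graph whose vertices are the non-zero zero divisors of the ring $\mathbb{Z}_n$ of integers modulo $n$ (non-zero $a$ such that $ab=0$ for some non-zero $b$), two distinct vertices $a,b$ being adjacent if and only if $ab=0$ in $\mathbb{Z}_n$. An independent set of a finite graph $G$ is a set of vertices no two of which are adjacent (the empty set included); $\alpha(G)$ is the maximum size of an independent set, and $s_k(G)$ is the number of independent sets of size $k$. The independence polynomial of $G$ is $I(G,x)=\sum_{k=0}^{\alpha(G)} s_k(G)x^k$. *)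

theory Defs
  imports
    "HOL-Number_Theory.Residues"
    "HOL-Computational_Algebra.Polynomial"
    "Graph_Theory.Graph_Theory"
    Complex_Main
begin

text \<open>
  A simple undirected graph is represented as a finite, loop-free, symmetric pair digraph
  (locale \<^locale>\<open>pair_graph\<close>): the edge between \<open>a\<close> and \<open>b\<close> is the pair of arcs
  \<open>(a, b)\<close> and \<open>(b, a)\<close>.
\<close>

definition independent_set :: "'a pair_pre_digraph \<Rightarrow> 'a set \<Rightarrow> bool" where
  "independent_set G S \<longleftrightarrow> S \<subseteq> pverts G \<and> (\<forall>a\<in>S. \<forall>b\<in>S. (a, b) \<notin> parcs G)"

text \<open>
  The next three definitions are meant for finite graphs only; there the empty set is
  independent, so the maximum ranges over a finite nonempty set.
\<close>

definition independence_number :: "'a pair_pre_digraph \<Rightarrow> nat" where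
  "independence_number G = Max {card S | S. independent_set G S}"

definition num_independent_sets :: "'a pair_pre_digraph \<Rightarrow> nat \<Rightarrow> nat" where
  "num_independent_sets G k = card {S. independent_set G S \<and> card S = k}"

definition independence_poly :: "'a pair_pre_digraph \<Rightarrow> 'b::comm_semiring_1 poly" where
  "independence_poly G =
     (\<Sum>k = 0..independence_number G. monom (of_nat (num_independent_sets G k)) k)"

definition nonzero_zero_divisors :: "('a, 'm) ring_scheme \<Rightarrow> 'a set" where
  "nonzero_zero_divisors R =
     {a \<in> carrier R - {\<zero>\<^bsub>R\<^esub>}. \<exists>b \<in> carrier R - {\<zero>\<^bsub>R\<^esub>}. a \<otimes>\<^bsub>R\<^esub> b = \<zero>\<^bsub>R\<^esub>}"

definition zero_divisor_graph :: "('a, 'm) ring_scheme \<Rightarrow> 'a pair_pre_digraph" where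
  "zero_divisor_graph R =
     \<lparr>pverts = nonzero_zero_divisors R,
      parcs = {(a, b). a \<in> nonzero_zero_divisors R \<and> b \<in> nonzero_zero_divisors R \<and>
                       a \<noteq> b \<and> a \<otimes>\<^bsub>R\<^esub> b = \<zero>\<^bsub>R\<^esub>}\<rparr>"

definition zero_divisor_graph_Z :: "nat \<Rightarrow> int pair_pre_digraph" where
  "zero_divisor_graph_Z n = zero_divisor_graph (residue_ring (int n))"

lemma pair_graph_zero_divisor_graph:
  assumes "cring R" "finite (carrier R)"
  shows "pair_graph (zero_divisor_graph R)"
proof -
  interpret cring R by fact
  have fin: "finite (nonzero_zero_divisors R)"
    using assms(2) by (simp add: nonzero_zero_divisors_def)
  have "finite (parcs (zero_divisor_graph R))"
    by (rule finite_subset[of _ "nonzero_zero_divisors R \<times> nonzero_zero_divisors R"])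
      (use fin in \<open>auto simp: zero_divisor_graph_def\<close>)
  moreover have "symmetric (zero_divisor_graph R)"
    by (auto simp: symmetric_def sym_def zero_divisor_graph_def nonzero_zero_divisors_def m_comm)
  ultimately show ?thesis
    using fin by unfold_locales (auto simp: zero_divisor_graph_def)
qed

lemma pair_graph_zero_divisor_graph_Z:
  assumes "n > 1"
  shows "pair_graph (zero_divisor_graph_Z n)"
proof -
  interpret residues "int n" "residue_ring (int n)"
    using assms by unfold_locales auto
  show ?thesis
    unfolding zero_divisor_graph_Z_def by (intro pair_graph_zero_divisor_graph cring finite)
qed

end

theory Submission
  imports Defs
begin

text \<open>
  The vertices fall into six independent classes according to which of \<open>p\<close>, \<open>q\<close>, \<open>r\<close> divide them:
  three classes of multiples of two primes, mutually completely joined, each with one further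
  class (the multiples of the remaining prime alone) completely joined to it. An independent set
  therefore meets at most one of the three core classes. With \<open>a = p - 1\<close>, \<open>b = q - 1\<close>, \<open>c = r - 1\<close> and
  \<open>y = 1 + x\<close> this gives \<open>I = y^(a(b+c)) f(y)\<close>, where
  \<open>f(y) = y^(bc) + y^(bc-ab+c) - y^(bc-ab) + y^(bc-ac+b) - y^(bc-ac) + y^a - 1\<close>.
  Apart from a possible cancellation and a possible coincidence of the two leading terms, the
  exponents of \<open>f\<close> are distinct, so the leading term dominates for \<open>\<bar>y\<bar> \<ge> 2\<close> and the constant term
  for \<open>\<bar>y\<bar> \<le> 1/2\<close>.
\<close>

section \<open>Independence polynomials as sums over independent sets\<close>

text \<open>Expanding a product of factors \<open>x + 1\<close>, one for each element of
  \<open>A\<close>, means choosing \<open>x\<close> or 1 at each element; taking \<open>x\<close>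
  exactly on \<open>S\<close> contributes \<open>x ^ card S\<close>.\<close>

lemma sum_Pow_monom_card:
  assumes "finite A"
  shows "(\<Sum>S\<in>Pow A. monom (1 :: 'a :: comm_semiring_1) (card S)) = [:1, 1:] ^ card A"
proof -
  have "[:1, 1:] ^ card A = (\<Prod>x\<in>A. monom 1 1 + (1 :: 'a poly))"
    by (simp add: monom_altdef one_pCons)
  also have "\<dots> = (\<Sum>S\<in>Pow A. monom 1 (card S))"
    unfolding prod_add[OF assms] by (simp add: monom_power)
  finally show ?thesis ..
qed

text \<open>Grouping the independent sets by size collects the coefficients. Finiteness lets the
  \<open>Max\<close> in \<open>independence_number\<close> bound every size, so no set is
  lost.\<close>

lemma independence_poly_eq_sum:
  assumes "finite (pverts G)"
  shows "independence_poly G =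
    (\<Sum>S | independent_set G S. monom (1 :: 'a :: comm_semiring_1) (card S))"
proof -
  have fin: "finite {S. independent_set G S}"
    by (rule finite_subset[of _ "Pow (pverts G)"]) (use assms in \<open>auto simp: independent_set_def\<close>)
  have le: "card S \<le> independence_number G" if "independent_set G S" for S
    unfolding independence_number_def using that fin by (intro Max_ge) auto
  have "(\<Sum>S | independent_set G S. monom (1::'a) (card S)) =
      (\<Sum>k = 0..independence_number G. \<Sum>S | S \<in> {S. independent_set G S} \<and> card S = k. monom 1 (card S))"
    by (rule sum.group[symmetric]) (use fin le in auto)
  also have "\<dots> = (\<Sum>k = 0..independence_number G.
      monom (of_nat (num_independent_sets G k)) k)"
    by (intro sum.cong refl)
      (simp add: num_independent_sets_def of_nat_poly [symmetric] of_nat_monom mult_monom)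
  finally show ?thesis
    unfolding independence_poly_def ..
qed

section \<open>Independent sets of a blown-up triangle with pendants\<close>

text \<open>A vertex of a core class Bi excludes Ai and the other two core classes, and nothing
  else. So an independent set either avoids the core, or is a subset of Bi and the two other A
  classes that meets Bi; each difference of powers discards the subsets missing Bi. \<open>R\<close>
  lists every block of edges in one direction only.\<close>

lemma independence_poly_triangle_with_pendants:
  fixes A1 A2 A3 B1 B2 B3 :: "'v set"
  defines "Y \<equiv> [:1, 1:] :: 'a :: comm_ring_1 poly"
    and "R \<equiv> A1 \<times> B1 \<union> A2 \<times> B2 \<union> A3 \<times> B3 \<union> B1 \<times> B2 \<union> B1 \<times> B3 \<union> B2 \<times> B3"
  assumes fin: "finite (pverts G)"
    and V: "pverts G = A1 \<union> A2 \<union> A3 \<union> B1 \<union> B2 \<union> B3"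
    and dA: "A1 \<inter> A2 = {}" "A1 \<inter> A3 = {}" "A2 \<inter> A3 = {}"
    and dB: "B1 \<inter> B2 = {}" "B1 \<inter> B3 = {}" "B2 \<inter> B3 = {}"
    and dAB: "(A1 \<union> A2 \<union> A3) \<inter> (B1 \<union> B2 \<union> B3) = {}"
    and E: "\<And>x y. x \<in> pverts G \<Longrightarrow> y \<in> pverts G \<Longrightarrow> 
      (x, y) \<in> parcs G \<longleftrightarrow> (x, y) \<in> R \<or> (y, x) \<in> R"
  shows "independence_poly G = Y ^ (card A1 + card A2 + card A3)
    + (Y ^ (card B1 + card A2 + card A3) - Y ^ (card A2 + card A3))
    + (Y ^ (card B2 + card A1 + card A3) - Y ^ (card A1 + card A3))
    + (Y ^ (card B3 + card A1 + card A2) - Y ^ (card A1 + card A2))"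
proof -
  define F0 where "F0 = Pow (A1 \<union> A2 \<union> A3)"
  define F1 where "F1 = Pow (B1 \<union> A2 \<union> A3) - Pow (A2 \<union> A3)"
  define F2 where "F2 = Pow (B2 \<union> A1 \<union> A3) - Pow (A1 \<union> A3)"
  define F3 where "F3 = Pow (B3 \<union> A1 \<union> A2) - Pow (A1 \<union> A2)"
  note F_defs = F0_def F1_def F2_def F3_def
  have finA: "finite A1" "finite A2" "finite A3" "finite B1" "finite B2" "finite B3"
    using fin unfolding V by auto
  have indep: "independent_set G S \<longleftrightarrow> S \<subseteq> pverts G \<and> (\<forall>x\<in>S. \<forall>y\<in>S. (x, y) \<notin> R)" for S
    unfolding independent_set_def using E by blast
  have indepI: "independent_set G S" if "S \<subseteq> C" "C \<subseteq> pverts G" "C \<times> C \<inter> R = {}" for S C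
    unfolding indep using that by blast
  have "independent_set G S \<longleftrightarrow> S \<in> F0 \<union> F1 \<union> F2 \<union> F3" for S
  proof
    assume S: "independent_set G S"
    then have sub: "S \<subseteq> A1 \<union> A2 \<union> A3 \<union> B1 \<union> B2 \<union> B3"
      by (simp add: indep V)
    have no: "x \<in> S \<Longrightarrow> y \<in> S \<Longrightarrow> (x, y) \<notin>
      A1 \<times> B1 \<union> A2 \<times> B2 \<union> A3 \<times> B3 \<union> B1 \<times> B2 \<union> B1 \<times> B3 \<union> B2 \<times> B3" for x y
      using S unfolding indep R_def by blast
    consider "S \<subseteq> A1 \<union> A2 \<union> A3" | b where "b \<in> S" "b \<in> B1" | b where "b \<in> S" "b \<in> B2"
      | b where "b \<in> S" "b \<in> B3"
      using sub by blast
    then show "S \<in> F0 \<union> F1 \<union> F2 \<union> F3"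
    proof cases
      case 1
      then show ?thesis by (simp add: F_defs)
    next
      case 2
      \<comment> \<open>\<open>no\<close> is applied with \<open>b\<close> on either side, which
        removes \<open>A1\<close>, \<open>B2\<close> and \<open>B3\<close> from \<open>S\<close>;
        \<open>b\<close> itself keeps \<open>S\<close> out of the subtracted power set.\<close>
      have "S \<subseteq> B1 \<union> A2 \<union> A3" using sub no[OF _ 2(1)] no[OF 2(1)] 2 by blast
      moreover have "\<not> S \<subseteq> A2 \<union> A3" using 2 dAB by blast
      ultimately show ?thesis by (simp add: F_defs)
    next
      case 3
      have "S \<subseteq> B2 \<union> A1 \<union> A3" using sub no[OF _ 3(1)] no[OF 3(1)] 3 by blast
      moreover have "\<not> S \<subseteq> A1 \<union> A3" using 3 dAB by blast
      ultimately show ?thesis by (simp add: F_defs)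
    next
      case 4
      have "S \<subseteq> B3 \<union> A1 \<union> A2" using sub no[OF _ 4(1)] no[OF 4(1)] 4 by blast
      moreover have "\<not> S \<subseteq> A1 \<union> A2" using 4 dAB by blast
      ultimately show ?thesis by (simp add: F_defs)
    qed
  next
    assume "S \<in> F0 \<union> F1 \<union> F2 \<union> F3"
    then consider "S \<subseteq> A1 \<union> A2 \<union> A3" | "S \<subseteq> B1 \<union> A2 \<union> A3" | "S \<subseteq> B2 \<union> A1 \<union> A3"
      | "S \<subseteq> B3 \<union> A1 \<union> A2"
      by (auto simp: F_defs)
    then show "independent_set G S"
    proof cases
      case 1
      \<comment> \<open>Every block of \<open>R\<close> has a factor disjoint from \<open>C\<close>,
        so \<open>C\<close> spans no edge; the other cases work alike.\<close>
      define C where "C = A1 \<union> A2 \<union> A3"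
      have "C \<inter> B1 = {}" "C \<inter> B2 = {}" "C \<inter> B3 = {}"
        using dA dB dAB unfolding C_def by blast+
      then have "C \<times> C \<inter> R = {}"
        by (simp add: R_def Int_Un_distrib Times_Int_Times)
      moreover have "C \<subseteq> pverts G" unfolding C_def V by blast
      ultimately show ?thesis using 1 indepI unfolding C_def by blast
    next
      case 2
      define C where "C = B1 \<union> A2 \<union> A3"
      have "C \<inter> A1 = {}" "C \<inter> B2 = {}" "C \<inter> B3 = {}"
        using dA dB dAB unfolding C_def by blast+
      then have "C \<times> C \<inter> R = {}"
        by (simp add: R_def Int_Un_distrib Times_Int_Times)
      moreover have "C \<subseteq> pverts G" unfolding C_def V by blast
      ultimately show ?thesis using 2 indepI unfolding C_def by blast
    next
      case 3
      define C where "C = B2 \<union> A1 \<union> A3"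
      have "C \<inter> A2 = {}" "C \<inter> B1 = {}" "C \<inter> B3 = {}"
        using dA dB dAB unfolding C_def by blast+
      then have "C \<times> C \<inter> R = {}"
        by (simp add: R_def Int_Un_distrib Times_Int_Times)
      moreover have "C \<subseteq> pverts G" unfolding C_def V by blast
      ultimately show ?thesis using 3 indepI unfolding C_def by blast
    next
      case 4
      define C where "C = B3 \<union> A1 \<union> A2"
      have "C \<inter> A3 = {}" "C \<inter> B1 = {}" "C \<inter> B2 = {}"
        using dA dB dAB unfolding C_def by blast+
      then have "C \<times> C \<inter> R = {}"
        by (simp add: R_def Int_Un_distrib Times_Int_Times)
      moreover have "C \<subseteq> pverts G" unfolding C_def V by blast
      ultimately show ?thesis using 4 indepI unfolding C_def by blast
    qed
  qed
  then have eq: "{S. independent_set G S} = F0 \<union> F1 \<union> F2 \<union> F3" by blast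
  have finF: "finite F0" "finite F1" "finite F2" "finite F3"
    using finA by (simp_all add: F_defs)
  \<comment> \<open>Members of \<open>F1\<close>, \<open>F2\<close>, \<open>F3\<close> meet the core
    in exactly the class of their own index, those of \<open>F0\<close> not at all.\<close>
  have disj: "F0 \<inter> F1 = {}" "(F0 \<union> F1) \<inter> F2 = {}" "(F0 \<union> F1 \<union> F2) \<inter> F3 = {}"
    unfolding F_defs using dB dAB by blast+
  have diff: "(\<Sum>S\<in>Pow C - Pow D. monom (1::'a) (card S)) = Y ^ card C - Y ^ card D"
    if "finite C" "D \<subseteq> C" for C D :: "'v set"
    unfolding Y_def using that
    by (subst sum_diff) (auto simp: sum_Pow_monom_card finite_subset Pow_mono)
  have "independence_poly G = (\<Sum>S\<in>F0 \<union> F1 \<union> F2 \<union> F3. monom (1::'a) (card S))"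
    using independence_poly_eq_sum[OF fin] unfolding eq .
  also have "\<dots> = (\<Sum>S\<in>F0. monom 1 (card S)) + (\<Sum>S\<in>F1. monom 1 (card S))
      + (\<Sum>S\<in>F2. monom 1 (card S)) + (\<Sum>S\<in>F3. monom 1 (card S))"
    using finF disj by (simp add: sum.union_disjoint)
  also have "(\<Sum>S\<in>F0. monom 1 (card S)) = Y ^ card (A1 \<union> A2 \<union> A3)"
    unfolding F0_def Y_def using finA by (intro sum_Pow_monom_card) simp
  also have "(\<Sum>S\<in>F1. monom 1 (card S)) = Y ^ card (B1 \<union> A2 \<union> A3) - Y ^ card (A2 \<union> A3)"
    unfolding F1_def using finA by (intro diff) auto
  also have "(\<Sum>S\<in>F2. monom 1 (card S)) = Y ^ card (B2 \<union> A1 \<union> A3) - Y ^ card (A1 \<union> A3)"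
    unfolding F2_def using finA by (intro diff) auto
  also have "(\<Sum>S\<in>F3. monom 1 (card S)) = Y ^ card (B3 \<union> A1 \<union> A2) - Y ^ card (A1 \<union> A2)"
    unfolding F3_def using finA by (intro diff) auto
  also have "card (A1 \<union> A2 \<union> A3) = card A1 + card A2 + card A3"
    using finA dA by (simp add: card_Un_disjoint Int_Un_distrib2)
  also have "card (B1 \<union> A2 \<union> A3) = card B1 + card A2 + card A3"
    using finA dA dAB by (subst card_Un_disjoint; auto)+
  also have "card (B2 \<union> A1 \<union> A3) = card B2 + card A1 + card A3"
    using finA dA dAB by (subst card_Un_disjoint; auto)+
  also have "card (B3 \<union> A1 \<union> A2) = card B3 + card A1 + card A2"
    using finA dA dAB by (subst card_Un_disjoint; auto)+
  also have "card (A2 \<union> A3) = card A2 + card A3"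
    using finA dA by (simp add: card_Un_disjoint)
  also have "card (A1 \<union> A3) = card A1 + card A3"
    using finA dA by (simp add: card_Un_disjoint)
  also have "card (A1 \<union> A2) = card A1 + card A2"
    using finA dA by (simp add: card_Un_disjoint)
  finally show ?thesis .
qed

section \<open>Sizes of the six classes\<close>

text \<open>By coprimality these are the numbers \<open>p * q * k\<close> with
  \<open>0 < k < r\<close>.\<close>

lemma card_multiples_of_two_primes:
  fixes p q r :: nat
  assumes "prime p" "prime q" "p \<noteq> q"
  shows "card {x. 0 < x \<and> x < int (p * q * r) \<and> int p dvd x \<and> int q dvd x} = r - 1"
proof -
  have pos: "0 < p * q" using assms by (simp add: prime_gt_0_nat)
  have cop: "coprime (int p) (int q)"
    using assms by (simp add: primes_coprime)
  have "{x. 0 < x \<and> x < int (p * q * r) \<and> int p dvd x \<and> int q dvd x} =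
      (\<lambda>k. int (p * q * k)) ` {1..<r}" (is "?L = ?R")
  proof (intro equalityI subsetI)
    fix x assume x: "x \<in> ?L"
    then have "int (p * q) dvd x"
      using cop by (simp add: divides_mult)
    moreover from x have "x = int (nat x)" by simp
    ultimately have "p * q dvd nat x" by (metis int_dvd_int_iff)
    then obtain k where k: "nat x = p * q * k" by (auto elim: dvdE)
    have "x = int (p * q * k)" using \<open>x = int (nat x)\<close> k by simp
    moreover from this x have "0 < p * q * k" "p * q * k < p * q * r"
      by (metis (mono_tags, lifting) mem_Collect_eq of_nat_0_less_iff of_nat_less_iff)+
    then have "k \<in> {1..<r}" using pos by auto
    ultimately show "x \<in> ?R" by blast
  next
    fix x assume "x \<in> ?R"
    then obtain k where k: "x = int (p * q * k)" and "k \<in> {1..<r}" by blast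
    then have "1 \<le> k" "k < r" by simp_all
    have "0 < p * q * k" "p * q * k < p * q * r" using pos \<open>1 \<le> k\<close> \<open>k < r\<close> by auto
    then have "0 < x" "x < int (p * q * r)"
      unfolding k by (simp_all only: of_nat_0_less_iff of_nat_less_iff)
    then show "x \<in> ?L" unfolding k by simp
  qed
  moreover have "inj_on (\<lambda>k. int (p * q * k)) {1..<r}"
    using pos by (auto simp: inj_on_def)
  ultimately show ?thesis by (simp add: card_image)
qed

text \<open>Dividing by \<open>p\<close> leaves the totatives of \<open>q * r\<close>, since
  \<open>q\<close> and \<open>r\<close> divide \<open>p * k\<close> only if they divide
  \<open>k\<close>; the totient is multiplicative.\<close>

lemma card_multiples_of_one_prime:
  fixes p q r :: nat
  assumes "prime p" "prime q" "prime r" "p \<noteq> q" "p \<noteq> r" "q \<noteq> r"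
  shows "card {x. 0 < x \<and> x < int (p * q * r) \<and> int p dvd x \<and> \<not> int q dvd x \<and> \<not> int r dvd x}
    = (q - 1) * (r - 1)"
proof -
  have pos: "0 < p" using assms by (simp add: prime_gt_0_nat)
  \<comment> \<open>Totatives of \<open>m\<close> range up to \<open>m\<close> inclusive; they are
    strictly below \<open>m\<close> only for \<open>m > 1\<close>.\<close>
  have gt: "1 < q * r"
    using assms by (metis nat_mult_eq_1_iff nat_neq_iff less_one mult_eq_0_iff not_prime_0 not_prime_1)
  have cop: "coprime q r" using assms by (simp add: primes_coprime)
  have coprime_iff: "coprime k l \<longleftrightarrow> \<not> l dvd k" if "prime l" for k l :: nat
    using that by (metis coprime_commute prime_imp_coprime coprime_absorb_left not_prime_unit)
  have dvd_iff: "l dvd p * k \<longleftrightarrow> l dvd k" if "prime l" "l \<noteq> p" for l k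
    using that assms(1) by (metis prime_dvd_mult_iff primes_dvd_imp_eq)
  have "{x. 0 < x \<and> x < int (p * q * r) \<and> int p dvd x \<and> \<not> int q dvd x \<and> \<not> int r dvd x} =
      (\<lambda>k. int (p * k)) ` totatives (q * r)" (is "?L = ?R")
  proof (intro equalityI subsetI)
    fix x assume x: "x \<in> ?L"
    then have "x = int (nat x)" by simp
    with x have "p dvd nat x" by (metis (mono_tags, lifting) int_dvd_int_iff mem_Collect_eq)
    then obtain k where k: "nat x = p * k" by (auto elim: dvdE)
    have xk: "x = int (p * k)" using \<open>x = int (nat x)\<close> k by simp
    have "0 < p * k" "p * k < p * q * r" "\<not> q dvd p * k" "\<not> r dvd p * k"
      using x unfolding xk mem_Collect_eq int_dvd_int_iff of_nat_0_less_iff of_nat_less_iff by auto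
    then have "k \<in> totatives (q * r)"
      using assms pos by (simp add: totatives_def coprime_iff[OF assms(2)] coprime_iff[OF assms(3)] dvd_iff mult.assoc)
    then show "x \<in> ?R" using xk by blast
  next
    fix x assume "x \<in> ?R"
    then obtain k where k: "x = int (p * k)" "k \<in> totatives (q * r)" by blast
    have "0 < k" "k < q * r" "\<not> q dvd k" "\<not> r dvd k"
      using k(2) totatives_less[OF k(2) gt] by (simp_all add: totatives_def coprime_iff[OF assms(2)] coprime_iff[OF assms(3)])
    then have "0 < p * k" "p * k < p * q * r" "\<not> q dvd p * k" "\<not> r dvd p * k"
      using assms pos by (simp_all add: dvd_iff mult.assoc)
    then show "x \<in> ?L"
      unfolding k(1) mem_Collect_eq int_dvd_int_iff of_nat_0_less_iff of_nat_less_iff by simp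
  qed
  moreover have "inj_on (\<lambda>k. int (p * k)) (totatives (q * r))"
    using pos by (auto simp: inj_on_def)
  ultimately show ?thesis
    using assms cop by (simp add: card_image totient_def[symmetric] totient_mult_coprime totient_prime)
qed

section \<open>The zero divisor graph of the integers modulo pqr\<close>

text \<open>A product vanishes iff each of the three primes divides one of the factors. Hence
  multiples of two primes annihilate each other across classes, and multiples of one prime alone are
  annihilated exactly by the class of the two others: the triangle with pendants.\<close>

lemma independence_poly_zero_divisor_graph_pqr:
  fixes p q r :: nat
  defines "Y \<equiv> [:1, 1:] :: 'a :: comm_ring_1 poly"
    and "a \<equiv> p - 1" and "b \<equiv> q - 1" and "c \<equiv> r - 1"
  assumes pr: "prime p" "prime q" "prime r" and ne: "p \<noteq> q" "p \<noteq> r" "q \<noteq> r"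
  shows "independence_poly (zero_divisor_graph_Z (p * q * r)) = Y ^ (b * c + a * c + a * b)
    + (Y ^ (a + a * c + a * b) - Y ^ (a * c + a * b))
    + (Y ^ (b + b * c + a * b) - Y ^ (b * c + a * b))
    + (Y ^ (c + b * c + a * c) - Y ^ (b * c + a * c))"
proof -
  define n where "n = int (p * q * r)"
  define G where "G = zero_divisor_graph_Z (p * q * r)"
  have gt1: "p > 1" "q > 1" "r > 1" using pr prime_gt_1_nat by blast+
  have n_dvd: "n dvd x \<longleftrightarrow> int p dvd x \<and> int q dvd x \<and> int r dvd x" for x
  proof
    assume "int p dvd x \<and> int q dvd x \<and> int r dvd x"
    then show "n dvd x"
      unfolding n_def using pr ne by (simp add: divides_mult primes_coprime)
  qed (auto simp: n_def intro: dvd_trans[rotated])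
  \<comment> \<open>Hiding divisibility behind \<open>D\<close> reduces the graph structure to
    propositional reasoning about which primes divide a vertex.\<close>
  define D where "D l x \<longleftrightarrow> int l dvd x" for l x
  have D_mult: "D l (x * y) \<longleftrightarrow> D l x \<or> D l y" if "prime l" for l x y
    using that unfolding D_def by (simp add: prime_dvd_mult_iff)
  have not_all_dvd: "\<not> (D p x \<and> D q x \<and> D r x)" if "0 < x" "x < n" for x
    using that n_dvd[of x] zdvd_not_zless unfolding D_def by blast
  have prod0: "x * y mod n = 0 \<longleftrightarrow> (D p x \<or> D p y) \<and> (D q x \<or> D q y) \<and> (D r x \<or> D r y)" for x y
    using n_dvd[of "x * y"] D_mult pr unfolding dvd_eq_mod_eq_0[symmetric] D_def by simp
  have verts: "pverts G = {x. 0 < x \<and> x < n \<and> (D p x \<or> D q x \<or> D r x)}"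
  proof -
    \<comment> \<open>Annihilators: the product of the two other primes kills every multiple of the
      given one.\<close>
    have "int (q * r) \<in> {y. 0 < y \<and> y < n}" "int (p * r) \<in> {y. 0 < y \<and> y < n}"
      "int (p * q) \<in> {y. 0 < y \<and> y < n}"
      using gt1 by (simp_all add: n_def)
    moreover have "D q (int (q * r))" "D r (int (q * r))" "D p (int (p * r))" "D r (int (p * r))"
      "D p (int (p * q))" "D q (int (p * q))"
      by (simp_all add: D_def)
    ultimately have "\<exists>y\<in>{y. 0 < y \<and> y < n}. x * y mod n = 0" if "D p x \<or> D q x \<or> D r x" for x
      unfolding prod0 using that by blast
    \<comment> \<open>Some prime fails to divide the nonzero residue \<open>y\<close>, so it must
      divide \<open>x\<close>.\<close>
    moreover have "D p x \<or> D q x \<or> D r x" if "y \<in> {y. 0 < y \<and> y < n}" "x * y mod n = 0" for x y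
      using that(2) not_all_dvd[of y] that(1) unfolding prod0 by blast
    ultimately have "(\<exists>y\<in>{y. 0 < y \<and> y < n}. x * y mod n = 0) \<longleftrightarrow> D p x \<or> D q x \<or> D r x" for x
      by metis
    moreover have "{0..n - 1} - {0} = {x. 0 < x \<and> x < n}" by auto
    then have "pverts G = {x \<in> {x. 0 < x \<and> x < n}. \<exists>y \<in> {x. 0 < x \<and> x < n}. x * y mod n = 0}"
      unfolding G_def zero_divisor_graph_Z_def zero_divisor_graph_def nonzero_zero_divisors_def
        residue_ring_def n_def[symmetric] by simp
    ultimately show ?thesis by simp
  qed
  have arcs: "(x, y) \<in> parcs G \<longleftrightarrow> (D p x \<or> D p y) \<and> (D q x \<or> D q y) \<and> (D r x \<or> D r y)"
    if "x \<in> pverts G" "y \<in> pverts G" for x y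
  proof -
    have x: "0 < x" "x < n" using that(1) unfolding verts by auto
    have "(x, y) \<in> parcs G \<longleftrightarrow> x \<noteq> y \<and> x * y mod n = 0"
      using that unfolding G_def zero_divisor_graph_Z_def zero_divisor_graph_def
        residue_ring_def n_def[symmetric] by simp
    \<comment> \<open>\<open>n\<close> is squarefree: \<open>x * x = 0\<close> would make all three
      primes divide \<open>x\<close>.\<close>
    moreover have "x * y mod n = 0 \<Longrightarrow> x \<noteq> y"
      using not_all_dvd[OF x] unfolding prod0 by blast
    ultimately show ?thesis unfolding prod0[symmetric] by auto
  qed
  define A1 where "A1 = {x. 0 < x \<and> x < n \<and> D p x \<and> \<not> D q x \<and> \<not> D r x}"
  define A2 where "A2 = {x. 0 < x \<and> x < n \<and> D q x \<and> \<not> D p x \<and> \<not> D r x}"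
  define A3 where "A3 = {x. 0 < x \<and> x < n \<and> D r x \<and> \<not> D p x \<and> \<not> D q x}"
  define B1 where "B1 = {x. 0 < x \<and> x < n \<and> D q x \<and> D r x}"
  define B2 where "B2 = {x. 0 < x \<and> x < n \<and> D p x \<and> D r x}"
  define B3 where "B3 = {x. 0 < x \<and> x < n \<and> D p x \<and> D q x}"
  note class_defs = A1_def A2_def A3_def B1_def B2_def B3_def
  have cards: "card A1 = b * c" "card A2 = a * c" "card A3 = a * b"
    "card B1 = a" "card B2 = b" "card B3 = c"
    using card_multiples_of_one_prime[of p q r] card_multiples_of_one_prime[of q p r]
      card_multiples_of_one_prime[of r p q] card_multiples_of_two_primes[of q r p]
      card_multiples_of_two_primes[of p r q] card_multiples_of_two_primes[of p q r] pr ne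
    unfolding class_defs D_def n_def a_def b_def c_def by (simp_all add: mult_ac)
  have "independence_poly G = Y ^ (card A1 + card A2 + card A3)
    + (Y ^ (card B1 + card A2 + card A3) - Y ^ (card A2 + card A3))
    + (Y ^ (card B2 + card A1 + card A3) - Y ^ (card A1 + card A3))
    + (Y ^ (card B3 + card A1 + card A2) - Y ^ (card A1 + card A2))"
    unfolding Y_def
  proof (rule independence_poly_triangle_with_pendants)
    show "finite (pverts G)"
      by (rule finite_subset[of _ "{0..n}"]) (auto simp: verts)
    show "pverts G = A1 \<union> A2 \<union> A3 \<union> B1 \<union> B2 \<union> B3"
      unfolding verts class_defs by blast
    show "A1 \<inter> A2 = {}" "A1 \<inter> A3 = {}" "A2 \<inter> A3 = {}"
      "(A1 \<union> A2 \<union> A3) \<inter> (B1 \<union> B2 \<union> B3) = {}"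
      unfolding class_defs by blast+
    show "B1 \<inter> B2 = {}" "B1 \<inter> B3 = {}" "B2 \<inter> B3 = {}"
      unfolding class_defs using not_all_dvd by blast+
    fix x y assume xy: "x \<in> pverts G" "y \<in> pverts G"
    then have x: "0 < x" "x < n" "D p x \<or> D q x \<or> D r x" and y: "0 < y" "y < n" "D p y \<or> D q y \<or> D r y"
      unfolding verts by auto
    show "(x, y) \<in> parcs G \<longleftrightarrow>
      (x, y) \<in> A1 \<times> B1 \<union> A2 \<times> B2 \<union> A3 \<times> B3 \<union> B1 \<times> B2 \<union> B1 \<times> B3 \<union> B2 \<times> B3 \<or>
      (y, x) \<in> A1 \<times> B1 \<union> A2 \<times> B2 \<union> A3 \<times> B3 \<union> B1 \<times> B2 \<union> B1 \<times> B3 \<union> B2 \<times> B3"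
      unfolding arcs[OF xy] class_defs using x y not_all_dvd[OF x(1,2)] not_all_dvd[OF y(1,2)]
      by (cases "D p x"; cases "D q x"; cases "D r x"; cases "D p y"; cases "D q y"; cases "D r y") simp_all
  qed
  then show ?thesis unfolding cards G_def by simp
qed

section \<open>Bounds for the roots of the cofactor\<close>

text \<open>The chain \<open>s < w < u, v < M \<le> N\<close> with \<open>s + 2 \<le> w\<close>
  spreads the exponents enough for comparison with a geometric series of ratio 1/2. Only
  \<open>u\<close> and \<open>v\<close> stay uncompared, and only \<open>M\<close> may equal
  \<open>N\<close>.\<close>

lemma seven_term_root_bounds:
  fixes y :: complex
  assumes eq: "y ^ N + y ^ M + y ^ v + y ^ s = y ^ u + y ^ w + 1"
    and ord: "0 < s" "s + 2 \<le> w" "w < u" "w < v" "u < M" "v < M" "M \<le> N"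
  shows "1 / 2 < cmod y" and "cmod y < 2"
proof -
  show "1 / 2 < cmod y"
  proof (rule ccontr)
    assume "\<not> 1 / 2 < cmod y"
    then have le: "cmod y \<le> 1 / 2" by simp
    have pow: "cmod (y ^ k) \<le> (1 / 2) ^ j" if "j \<le> k" for j k
    proof -
      have "cmod (y ^ k) \<le> (1 / 2) ^ k"
        unfolding norm_power using le by (intro power_mono) auto
      also have "\<dots> \<le> (1 / 2) ^ j" using that by (intro power_decreasing) auto
      finally show ?thesis .
    qed
    have "1 = y ^ N + y ^ M + y ^ v + y ^ s - y ^ u - y ^ w" using eq by (simp add: algebra_simps)
    then have "1 = cmod (y ^ N + y ^ M + y ^ v + y ^ s - y ^ u - y ^ w)" by (metis norm_one)
    also have "\<dots> \<le> cmod (y ^ N) + cmod (y ^ M) + cmod (y ^ v) + cmod (y ^ s)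
        + cmod (y ^ u) + cmod (y ^ w)"
      by (intro norm_triangle_le norm_triangle_le_diff add_mono order_refl)
    \<comment> \<open>The chain gives \<open>s \<ge> 1\<close>, \<open>w \<ge> 3\<close>,
      \<open>u, v \<ge> 4\<close>, \<open>M, N \<ge> 5\<close>; the sum is 13/16.\<close>
    also have "\<dots> \<le> (1/2)^5 + (1/2)^5 + (1/2)^4 + (1/2)^1 + (1/2)^4 + (1/2)^3"
      using ord by (intro add_mono pow) linarith+
    finally show False by (simp add: power_divide)
  qed
  show "cmod y < 2"
  proof (rule ccontr)
    assume "\<not> cmod y < 2"
    then have ge: "2 \<le> cmod y" by simp
    define T where "T = cmod (y ^ N)"
    have T: "T > 0" unfolding T_def norm_power using ge by (intro zero_less_power) linarith
    \<comment> \<open>Each unit by which an exponent falls short of \<open>N\<close> gains a factor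
      1/2 relative to \<open>T\<close>.\<close>
    have pow: "cmod (y ^ k) \<le> T / 2 ^ j" if "k + j \<le> N" for j k
    proof -
      have "cmod (y ^ k) * 2 ^ j \<le> cmod y ^ k * cmod y ^ j"
        unfolding norm_power using ge by (intro mult_left_mono power_mono) auto
      also have "\<dots> \<le> T"
        unfolding T_def norm_power power_add[symmetric] using that ge
        by (intro power_increasing) auto
      finally show ?thesis by (simp add: field_simps)
    qed
    \<comment> \<open>If \<open>M = N\<close> the doubled leading term compensates for \<open>u = v\<close>; otherwise \<open>y ^ u\<close> and \<open>y ^ v\<close>
      must cancel or have distinct exponents for the geometric bound to stay below \<open>T\<close>.\<close>
    consider "M = N" | "M < N" "u = v" | "M < N" "u < v" | "M < N" "v < u" using ord by linarith
    then show False
    proof cases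
      case 1
      have "2 * y ^ N = y ^ u + y ^ w + 1 - y ^ v - y ^ s"
        using eq 1 by (simp add: algebra_simps)
      then have "2 * T = cmod (y ^ u + y ^ w + y ^ 0 - y ^ v - y ^ s)"
        unfolding T_def by (metis norm_mult norm_numeral power_0)
      also have "\<dots> \<le> cmod (y ^ u) + cmod (y ^ w) + cmod (y ^ 0) + cmod (y ^ v) + cmod (y ^ s)"
        by (intro norm_triangle_le norm_triangle_le_diff add_mono order_refl)
      \<comment> \<open>The gaps below \<open>N\<close> follow from the chain; the total is 43/32 of
        \<open>T\<close>, against \<open>2 * T\<close> on the left.\<close>
      also have "\<dots> \<le> T / 2^1 + T / 2^2 + T / 2^5 + T / 2^1 + T / 2^4"
        using ord 1 by (intro add_mono pow) linarith+
      finally show False using T by simp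
    next
      case 2
      have "y ^ N = y ^ w + y ^ 0 - y ^ M - y ^ s"
        using eq 2 by (simp add: algebra_simps)
      then have "T = cmod (y ^ w + y ^ 0 - y ^ M - y ^ s)"
        unfolding T_def by simp
      also have "\<dots> \<le> cmod (y ^ w) + cmod (y ^ 0) + cmod (y ^ M) + cmod (y ^ s)"
        by (intro norm_triangle_le norm_triangle_le_diff add_mono order_refl)
      also have "\<dots> \<le> T / 2^3 + T / 2^6 + T / 2^1 + T / 2^5"
        using ord 2 by (intro add_mono pow) linarith+
      finally show False using T by simp
    next
      case 3
      have "y ^ N = y ^ u + y ^ w + y ^ 0 - y ^ M - y ^ v - y ^ s"
        using eq by (simp add: algebra_simps)
      then have "T = cmod (y ^ u + y ^ w + y ^ 0 - y ^ M - y ^ v - y ^ s)"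
        unfolding T_def by simp
      also have "\<dots> \<le> cmod (y ^ u) + cmod (y ^ w) + cmod (y ^ 0) + cmod (y ^ M)
          + cmod (y ^ v) + cmod (y ^ s)"
        by (intro norm_triangle_le norm_triangle_le_diff add_mono order_refl)
      \<comment> \<open>All exponents are now distinct, so distinct powers of 1/2 occur, with sum
        123/128.\<close>
      also have "\<dots> \<le> T / 2^3 + T / 2^4 + T / 2^7 + T / 2^1 + T / 2^2 + T / 2^6"
        using ord 3 by (intro add_mono pow) linarith+
      finally show False using T by simp
    next
      case 4
      have "y ^ N = y ^ u + y ^ w + y ^ 0 - y ^ M - y ^ v - y ^ s"
        using eq by (simp add: algebra_simps)
      then have "T = cmod (y ^ u + y ^ w + y ^ 0 - y ^ M - y ^ v - y ^ s)"
        unfolding T_def by simp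
      also have "\<dots> \<le> cmod (y ^ u) + cmod (y ^ w) + cmod (y ^ 0) + cmod (y ^ M)
          + cmod (y ^ v) + cmod (y ^ s)"
        by (intro norm_triangle_le norm_triangle_le_diff add_mono order_refl)
      also have "\<dots> \<le> T / 2^2 + T / 2^4 + T / 2^7 + T / 2^1 + T / 2^3 + T / 2^6"
        using ord 4 by (intro add_mono pow) linarith+
      finally show False using T by simp
    qed
  qed
qed

section \<open>Multiplicity of -1 and location of the other zeros\<close>

theorem theorem4p2:
  fixes p q r :: nat
  assumes "prime p" and "prime q" and "prime r" and "p < q" and "q < r"
  shows "poly (independence_poly (zero_divisor_graph_Z (p * q * r)) :: complex poly) (- 1) = 0
    \<and> Polynomial.order (- 1) (independence_poly (zero_divisor_graph_Z (p * q * r)) :: complex poly)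
        = (p - 1) * (q + r - 2)
    \<and> (\<forall>x::complex.
          poly (independence_poly (zero_divisor_graph_Z (p * q * r))) x = 0 \<and> x \<noteq> - 1 \<longrightarrow>
          1 / 2 < cmod (1 + x) \<and> cmod (1 + x) < 2)"
proof -
  let ?I = "independence_poly (zero_divisor_graph_Z (p * q * r)) :: complex poly"
  define Y where "Y = ([:1, 1:] :: complex poly)"
  \<comment> \<open>The differences \<open>d\<close>, \<open>e\<close> avoid truncated subtraction in the exponents.\<close>
  define a d e where "a = p - 1" and "d = q - p" and "e = r - q"
  define b c where "b = a + d" and "c = b + e"
  have "p > 1" using assms prime_gt_1_nat by blast
  then have pos: "0 < a" "0 < d" "0 < e" and bc: "q - 1 = b" "r - 1 = c"
    and m: "(p - 1) * (q + r - 2) = a * (b + c)"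
    using assms by (auto simp: a_def b_def c_def d_def e_def)
  \<comment> \<open>As \<open>c - a = d + e\<close> and \<open>b - a = d\<close>, these are the
    exponents bc, bc-ab+c, bc-ab, bc-ac+b and bc-ac in subtraction-free form.\<close>
  define N M u v w where "N = b * c" and "M = c + b * (d + e)" and "u = b * (d + e)"
    and "v = b + c * d" and "w = c * d"
  note exp_defs = N_def M_def u_def v_def w_def
  have ord: "0 < a" "a + 2 \<le> w" "w < u" "w < v" "u < M" "v < M" "u < N" "v < N"
  proof -
    have "c * 1 \<le> c * d" "1 * c \<le> a * c"
      using pos by (intro mult_left_mono mult_right_mono; simp)+
    then have le: "c \<le> c * d" "c \<le> a * c" by simp_all
    \<comment> \<open>This decides two comparisons: \<open>u - w = a * e\<close> and
      \<open>M - v = a * e + e\<close>.\<close>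
    have ae: "0 < a * e" using pos by simp
    show "0 < a" "w < v" "u < M" using pos by (simp_all add: exp_defs b_def c_def)
    have "a + 2 \<le> c" using pos by (simp add: b_def c_def)
    with le(1) show "a + 2 \<le> w" unfolding w_def by linarith
    show "w < u" using ae by (simp add: exp_defs b_def c_def algebra_simps)
    show "v < M" using ae pos by (simp add: exp_defs b_def c_def algebra_simps)
    show "u < N" using pos by (simp add: exp_defs b_def c_def)
    have "b < c" using pos by (simp add: c_def)
    moreover have "N = a * c + c * d" by (simp add: N_def b_def algebra_simps)
    ultimately show "v < N" unfolding v_def using le(2) by linarith
  qed
  define F where "F = Y ^ N + Y ^ M + Y ^ v + Y ^ a - Y ^ u - Y ^ w - 1"
  have "?I = Y ^ (b * c + a * c + a * b) + (Y ^ (a + a * c + a * b) - Y ^ (a * c + a * b))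
    + (Y ^ (b + b * c + a * b) - Y ^ (b * c + a * b))
    + (Y ^ (c + b * c + a * c) - Y ^ (b * c + a * c))"
    using independence_poly_zero_divisor_graph_pqr[of p q r, where 'a = complex] assms
    unfolding bc a_def[symmetric] Y_def by simp
  also have "\<dots> = Y ^ (a * (b + c)) * F"
  proof -
    \<comment> \<open>Each exponent splits into the common \<open>a * (b + c)\<close> and an
      exponent of \<open>F\<close>; the \<open>+ 0\<close> yields the constant term -1.\<close>
    have "b * c + a * c + a * b = a * (b + c) + N" "a + a * c + a * b = a * (b + c) + a"
      "a * c + a * b = a * (b + c) + 0" "b + b * c + a * b = a * (b + c) + v"
      "b * c + a * b = a * (b + c) + w" "c + b * c + a * c = a * (b + c) + M"
      "b * c + a * c = a * (b + c) + u"
      by (simp_all add: exp_defs b_def c_def algebra_simps)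
    then show ?thesis
      unfolding F_def by (simp only: power_add) (simp add: algebra_simps)
  qed
  finally have I: "?I = Y ^ (a * (b + c)) * F" .
  have polyY: "poly Y x = 1 + x" for x by (simp add: Y_def)
  \<comment> \<open>At \<open>x = -1\<close> every power in \<open>F\<close> vanishes because its
    exponent is positive, leaving -1; so the whole multiplicity comes from the power of
    \<open>Y\<close>.\<close>
  have F_m1: "poly F (- 1) \<noteq> 0"
    using ord by (simp add: F_def polyY power_0_left)
  then have "F \<noteq> 0" by auto
  moreover have "Y \<noteq> 0" by (simp add: Y_def)
  ultimately have "order (- 1) ?I = order (- 1) (Y ^ (a * (b + c))) + order (- 1) F"
    unfolding I by (intro order_mult) simp
  also have "order (- 1) F = 0" using F_m1 by (rule order_0I)
  also have "order (- 1) (Y ^ (a * (b + c))) = a * (b + c)"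
    using order_power_n_n[of "- 1 :: complex"] by (simp add: Y_def)
  finally have order: "order (- 1) ?I = (p - 1) * (q + r - 2)" unfolding m by simp
  have "1 / 2 < cmod (1 + x) \<and> cmod (1 + x) < 2" if "poly ?I x = 0" "x \<noteq> - 1" for x
  proof -
    have "1 + x \<noteq> 0" using that(2) by (simp add: add_eq_0_iff)
    then have "poly F x = 0" using that(1) by (simp add: I polyY)
    then have eq: "(1 + x) ^ N + (1 + x) ^ M + (1 + x) ^ v + (1 + x) ^ a =
        (1 + x) ^ u + (1 + x) ^ w + 1"
      by (simp add: F_def polyY algebra_simps)
    \<comment> \<open>Either of \<open>M\<close> and \<open>N\<close> may be the degree of
      \<open>F\<close>, so the bounds are applied with both role assignments; one of
      \<open>M \<le> N\<close> and \<open>N \<le> M\<close> holds.\<close>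
    then have eq': "(1 + x) ^ M + (1 + x) ^ N + (1 + x) ^ v + (1 + x) ^ a =
        (1 + x) ^ u + (1 + x) ^ w + 1"
      by (simp add: add.commute)
    show ?thesis
      using seven_term_root_bounds[OF eq ord(1-6)] seven_term_root_bounds[OF eq' ord(1-4,7,8)]
      by linarith
  qed
  moreover have "poly ?I (- 1) = 0"
    using pos by (simp add: I polyY b_def)
  ultimately show ?thesis using order by blast
qed

end
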